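(* Let $N\ge 2$ and let $d_1,\dots,d_N\ge 2$ be integers. Let $\rho$ be a quantum state (density operator) on $\mathbb{C}^{d_1}\otimes\cdots\otimes\mathbb{C}^{d_N}$, and for each party $i\in\{1,\dots,N\}$ let $\hat u_i,\hat v_i$ be two observables on $\mathbb{C}^{d_i}$, each with outcomes labelled by $\{1,\dots,d_i\}$. Let $P(x_1\dots x_N|X_1\dots X_N)$, with $X_i\in\{\hat u_i,\hat v_i\}$ and $x_i\in\{1,\dots,d_i\}$, be the joint outcome probabilities obtained by measuring $X_1,\dots,X_N$ locally on $\rho$. Suppose that for some fixed $j\in\{1,\dots,N\}$ the following conditions all hold: 1. $P(1\dots 1|\hat u_1\dots\hat u_N)=q>0$; 2. for every $r\in\{1,\dots,N\}$ and every $x\in\{1,\dots,d_r-1\}$, $$P(1\dots 1\,x\,1\dots 1|\hat u_1\dots\hat u_{r-1}\hat v_r\hat u_{r+1}\dots\hat u_N)=0,$$ where $x$ is the outcome of party $r$ and all other outcomes are $1$; 3. for every $i\in\{1,\dots,N\}$ with $i\ne j$, the probability that parties $i$ and $j$ obtain outcomes $d_i$ and $d_j$ respectively and all other parties obtain outcome $1$, when parties $i$ and $j$ measure $\hat v_i$ and $\hat v_j$ and every other party $k$ measures $\hat u_k$, is equal to $0$. Then the correlation $P$ is genuinely $N$-way NS nonlocal (that is, $P$ is not $NS_2$-local).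
   Context: Measurements: an observable on $\mathbb{C}^{d}$ with outcomes $\{1,\dots,d\}$ is a projective measurement, i.e. a family $(\Pi_1,\dots,\Pi_d)$ of mutually orthogonal projections summing to the identity. If the observable $X_i$ of party $i$ has projections $\Pi^{X_i}_{1},\dots,\Pi^{X_i}_{d_i}$, then $P(x_1\dots x_N|X_1\dots X_N)=\mathrm{Tr}\big[\rho\,(\Pi^{X_1}_{x_1}\otimes\cdots\otimes\Pi^{X_N}_{x_N})\big]$. Correlations: for a nonempty set $\alpha\subseteq\{1,\dots,N\}$ of parties, write $\Omega_\alpha=(X_i)_{i\in\alpha}$ for a tuple of measurement settings, $X_i\in\{\hat u_i,\hat v_i\}$ (the two settings being regarded as distinct labels), and $\Lambda_\alpha=(x_i)_{i\in\alpha}$ for a tuple of outcomes, $x_i\in\{1,\dots,d_i\}$; write $\Omega_N,\Lambda_N$ when $\alpha=\{1,\dots,N\}$. A correlation on $\alpha$ is a family of probability distributions $Q(\Lambda_\alpha|\Omega_\alpha)$ over $\Lambda_\alpha$, one for each $\Omega_\alpha$ (nonnegative and normalized). It is non-signaling if, for every $i\in\alpha$, the sum $\sum_{x_i=1}^{d_i}Q(\Lambda_\alpha|\Omega_\alpha)$ does not depend on the setting $X_i$ of party $i$ (for all fixed values of the other parties' outcomes and settings). $NS_2$-locality: a correlation $P(\Lambda_N|\Omega_N)$ is $NS_2$-local if it can be written as $$P(\Lambda_N|\Omega_N)=\sum_{\alpha}\sum_\lambda q_{\alpha,\lambda}\,Q_{\alpha,\lambda}(\Lambda_\alpha|\Omega_\alpha)\,R_{\bar\alpha,\lambda}(\Lambda_{\bar\alpha}|\Omega_{\bar\alpha})\quad\text{for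 all }\Lambda_N,\Omega_N,$$ where $\alpha$ ranges over the subsets of $\{1,\dots,N\}$ with $1\le|\alpha|\le N-1$, $\bar\alpha$ is the complement of $\alpha$, $\lambda$ ranges over a countable index set, $q_{\alpha,\lambda}\ge 0$ with $\sum_{\alpha,\lambda}q_{\alpha,\lambda}=1$, and each $Q_{\alpha,\lambda}$ and $R_{\bar\alpha,\lambda}$ is a non-signaling correlation on $\alpha$, respectively $\bar\alpha$. Otherwise $P$ is called genuinely $N$-way NS nonlocal. *)

theory Defs
  imports
    "HOL-Analysis.Infinite_Sum"
    "Jordan_Normal_Form.Schur_Decomposition"
begin

section \<open>States and measurements\<close>

definition mat_trace :: "complex mat \<Rightarrow> complex" where
  "mat_trace A = (\<Sum>i<dim_row A. A $$ (i, i))"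

text \<open>In the notation of Jordan Normal Form, \<open>x \<bullet>c v\<close> conjugates its second argument. The order on
  \<^typ>\<open>complex\<close> is the one with \<open>0 \<le> z\<close> iff \<open>z\<close> is real and nonnegative.\<close>

definition density_operator :: "nat \<Rightarrow> complex mat \<Rightarrow> bool" where
  "density_operator n \<rho> \<longleftrightarrow>
     \<rho> \<in> carrier_mat n n \<and> mat_adjoint \<rho> = \<rho> \<and>
     (\<forall>v\<in>carrier_vec n. 0 \<le> (\<rho> *\<^sub>v v) \<bullet>c v) \<and> mat_trace \<rho> = 1"

definition projection :: "nat \<Rightarrow> complex mat \<Rightarrow> bool" where
  "projection n A \<longleftrightarrow> A \<in> carrier_mat n n \<and> mat_adjoint A = A \<and> A * A = A"

text \<open>The projections of an observable may have any rank, including zero.\<close>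

definition observable :: "nat \<Rightarrow> (nat \<Rightarrow> complex mat) \<Rightarrow> bool" where
  "observable n M \<longleftrightarrow>
     (\<forall>x\<in>{1..n}. projection n (M x)) \<and>
     (\<forall>x\<in>{1..n}. \<forall>y\<in>{1..n}. x \<noteq> y \<longrightarrow> M x * M y = 0\<^sub>m n n) \<and>
     finsum (ring_mat TYPE(complex) n ()) M {1..n} = 1\<^sub>m n"

text \<open>The space \<open>\<complex>\<^bsup>d 1\<^esup> \<otimes> \<dots> \<otimes> \<complex>\<^bsup>d N\<^esup>\<close> is identified with the coordinate space of dimension
  \<open>d 1 * \<dots> * d N\<close> by ordering the product basis lexicographically, the first party being the most
  significant; tensor products of operators then become Kronecker products.\<close>

definition kronecker :: "complex mat \<Rightarrow> complex mat \<Rightarrow> complex mat" where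
  "kronecker A B =
     mat (dim_row A * dim_row B) (dim_col A * dim_col B)
       (\<lambda>(i, k). A $$ (i div dim_row B, k div dim_col B) * B $$ (i mod dim_row B, k mod dim_col B))"

primrec tensor_upto :: "nat \<Rightarrow> (nat \<Rightarrow> complex mat) \<Rightarrow> complex mat" where
  "tensor_upto 0 A = 1\<^sub>m 1"
| "tensor_upto (Suc n) A = kronecker (tensor_upto n A) (A (Suc n))"

lemma tensor_upto_carrier:
  assumes "\<And>i. i \<in> {1..n} \<Longrightarrow> A i \<in> carrier_mat (d i) (d i)"
  shows "tensor_upto n A \<in> carrier_mat (\<Prod>i\<in>{1..n}. d i) (\<Prod>i\<in>{1..n}. d i)"
  using assms
proof (induction n)
  case (Suc n)
  have "tensor_upto n A \<in> carrier_mat (\<Prod>i\<in>{1..n}. d i) (\<Prod>i\<in>{1..n}. d i)"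
    using Suc by simp
  moreover have "A (Suc n) \<in> carrier_mat (d (Suc n)) (d (Suc n))"
    using Suc.prems by simp
  ultimately show ?case
    by (auto simp: kronecker_def)
qed simp

section \<open>Correlations\<close>

datatype setting = U | V

text \<open>A correlation on \<open>\<alpha>\<close> is evaluated only on tuples indexed by \<open>\<alpha>\<close>: its first argument is a tuple
  of outcomes, its second a tuple of settings.\<close>

type_synonym correlation = "(nat \<Rightarrow> nat) \<Rightarrow> (nat \<Rightarrow> setting) \<Rightarrow> real"

definition outcomes :: "(nat \<Rightarrow> nat) \<Rightarrow> nat set \<Rightarrow> (nat \<Rightarrow> nat) set" where
  "outcomes d \<alpha> = (\<Pi>\<^sub>E i\<in>\<alpha>. {1..d i})"

definition settings :: "nat set \<Rightarrow> (nat \<Rightarrow> setting) set" where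
  "settings \<alpha> = (\<Pi>\<^sub>E i\<in>\<alpha>. UNIV)"

definition is_correlation :: "(nat \<Rightarrow> nat) \<Rightarrow> nat set \<Rightarrow> correlation \<Rightarrow> bool" where
  "is_correlation d \<alpha> Q \<longleftrightarrow>
     (\<forall>X\<in>settings \<alpha>. (\<forall>x\<in>outcomes d \<alpha>. 0 \<le> Q x X) \<and> (\<Sum>x\<in>outcomes d \<alpha>. Q x X) = 1)"

definition non_signaling :: "(nat \<Rightarrow> nat) \<Rightarrow> nat set \<Rightarrow> correlation \<Rightarrow> bool" where
  "non_signaling d \<alpha> Q \<longleftrightarrow>
     (\<forall>i\<in>\<alpha>. \<forall>x\<in>outcomes d \<alpha>. \<forall>X\<in>settings \<alpha>. \<forall>s s'.
        (\<Sum>y\<in>{1..d i}. Q (x(i := y)) (X(i := s))) = (\<Sum>y\<in>{1..d i}. Q (x(i := y)) (X(i := s'))))"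

definition ns_correlation :: "(nat \<Rightarrow> nat) \<Rightarrow> nat set \<Rightarrow> correlation \<Rightarrow> bool" where
  "ns_correlation d \<alpha> Q \<longleftrightarrow> is_correlation d \<alpha> Q \<and> non_signaling d \<alpha> Q"

text \<open>The observables \<open>u i\<close> and \<open>v i\<close> of party \<open>i\<close> are given by their projections \<open>u i x\<close> and \<open>v i x\<close>.
  The trace below is real, since it pairs two Hermitian operators, so taking the real part only
  changes the type.\<close>

definition quantum_correlation ::
  "nat \<Rightarrow> complex mat \<Rightarrow> (nat \<Rightarrow> nat \<Rightarrow> complex mat) \<Rightarrow> (nat \<Rightarrow> nat \<Rightarrow> complex mat) \<Rightarrow> correlation" where
  "quantum_correlation N \<rho> u v x X =
     Re (mat_trace (\<rho> * tensor_upto N (\<lambda>i. case X i of U \<Rightarrow> u i (x i) | V \<Rightarrow> v i (x i))))"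

section \<open>Locality\<close>

definition proper_parts :: "nat \<Rightarrow> nat set set" where
  "proper_parts N = {\<alpha>. \<alpha> \<subseteq> {1..N} \<and> 1 \<le> card \<alpha> \<and> card \<alpha> \<le> N - 1}"

text \<open>Countable index sets are represented by sets of natural numbers.\<close>

definition NS2_local :: "nat \<Rightarrow> (nat \<Rightarrow> nat) \<Rightarrow> correlation \<Rightarrow> bool" where
  "NS2_local N d P \<longleftrightarrow>
     (\<exists>(L :: nat set) (q :: nat set \<Rightarrow> nat \<Rightarrow> real)
        (Q :: nat set \<Rightarrow> nat \<Rightarrow> correlation) (R :: nat set \<Rightarrow> nat \<Rightarrow> correlation).
        (\<forall>\<alpha>\<in>proper_parts N. \<forall>l\<in>L.
            0 \<le> q \<alpha> l \<and> ns_correlation d \<alpha> (Q \<alpha> l) \<and> ns_correlation d ({1..N} - \<alpha>) (R \<alpha> l)) \<and>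
        ((\<lambda>(\<alpha>, l). q \<alpha> l) has_sum 1) (proper_parts N \<times> L) \<and>
        (\<forall>x\<in>outcomes d {1..N}. \<forall>X\<in>settings {1..N}.
            ((\<lambda>(\<alpha>, l). q \<alpha> l * Q \<alpha> l (restrict x \<alpha>) (restrict X \<alpha>)
                 * R \<alpha> l (restrict x ({1..N} - \<alpha>)) (restrict X ({1..N} - \<alpha>)))
              has_sum P x X) (proper_parts N \<times> L)))"

definition genuinely_NS_nonlocal :: "nat \<Rightarrow> (nat \<Rightarrow> nat) \<Rightarrow> correlation \<Rightarrow> bool" where
  "genuinely_NS_nonlocal N d P \<longleftrightarrow> \<not> NS2_local N d P"

end

theory Submission
  imports Defs
begin

text \<open>Every term of an \<open>NS\<^sub>2\<close>-local decomposition is nonnegative, so a vanishing probability forces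
  all its terms to vanish. Condition 1 gives a term whose two factors
  are positive at the all-ones outcome for the settings \<open>U\<close>. When a party \<open>r\<close> switches to \<open>V\<close>,
  non-signaling preserves the positive marginal of the other parties in its factor, while
  condition 2 excludes all its outcomes but \<open>d r\<close>; hence that factor is positive at outcome \<open>d r\<close>.
  Choosing \<open>i\<close> in the part not containing \<open>j\<close>, both factors can be switched independently, which
  makes the term positive where condition 3 requires it to vanish.\<close>

lemma ns_correlation_nonneg:
  assumes "ns_correlation d \<alpha> Q" "x \<in> outcomes d \<alpha>" "X \<in> settings \<alpha>"
  shows "0 \<le> Q x X"
  using assms by (simp add: ns_correlation_def is_correlation_def)

lemma outcomes_fun_upd:
  assumes "x \<in> outcomes d \<alpha>" "r \<in> \<alpha>" "y \<in> {1..d r}"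
  shows "x(r := y) \<in> outcomes d \<alpha>"
  using assms by (auto simp: outcomes_def PiE_iff extensional_def)

lemma settings_fun_upd:
  assumes "X \<in> settings \<alpha>" "r \<in> \<alpha>"
  shows "X(r := s) \<in> settings \<alpha>"
  using assms by (auto simp: settings_def PiE_iff extensional_def)

lemma outcomes_restrict:
  assumes "x \<in> outcomes d \<beta>" "\<alpha> \<subseteq> \<beta>"
  shows "restrict x \<alpha> \<in> outcomes d \<alpha>"
  using assms by (auto simp: outcomes_def PiE_iff)

text \<open>Counterpart of \<open>restrict_fupd\<close>, which drops an update outside the set.
  Together they determine which updates each factor of a product term sees.\<close>

lemma restrict_fupd_in:
  assumes "i \<in> A"
  shows "restrict (f(i := y)) A = (restrict f A)(i := y)"
  using assms by auto

lemma settings_restrict: "restrict X \<alpha> \<in> settings \<alpha>"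
  by (simp add: settings_def)

text \<open>Summed over the outcomes of \<open>r\<close>, \<open>Q\<close> gives at least
  \<open>Q x X > 0\<close> under the setting \<open>X r\<close>, and by non-signaling the same value
  under \<open>s\<close>. There \<open>zero\<close> leaves only the summand at \<open>d r\<close>,
  which must carry all of it.\<close>

lemma ns_correlation_pos_switch:
  assumes ns: "ns_correlation d \<alpha> Q"
    and x: "x \<in> outcomes d \<alpha>" and X: "X \<in> settings \<alpha>" and r: "r \<in> \<alpha>"
    and pos: "0 < Q x X"
    and zero: "\<And>y. y \<in> {1..d r - 1} \<Longrightarrow> Q (x(r := y)) (X(r := s)) = 0"
  shows "0 < Q (x(r := d r)) (X(r := s))"
proof -
  have xr: "x r \<in> {1..d r}"
    using x r by (auto simp: outcomes_def)
  have nonneg: "0 \<le> Q (x(r := y)) (X(r := s'))" if "y \<in> {1..d r}" for y s'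
    using ns_correlation_nonneg[OF ns outcomes_fun_upd[OF x r that] settings_fun_upd[OF X r]] .
  have "Q x X \<le> (\<Sum>y\<in>{1..d r}. Q (x(r := y)) X)"
    using member_le_sum[OF xr, of "\<lambda>y. Q (x(r := y)) X"] nonneg[of _ "X r"] by simp
  also have "\<dots> = (\<Sum>y\<in>{1..d r}. Q (x(r := y)) (X(r := s)))"
  proof -
    \<comment> \<open>Writing \<open>X\<close> as \<open>X(r := X r)\<close> brings the sum into the
      shape of \<open>non_signaling\<close>.\<close>
    have "(\<Sum>y\<in>{1..d r}. Q (x(r := y)) (X(r := X r))) = (\<Sum>y\<in>{1..d r}. Q (x(r := y)) (X(r := s)))"
      using ns x X r unfolding ns_correlation_def non_signaling_def by blast
    then show ?thesis by simp
  qed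
  also have "\<dots> = (\<Sum>y\<in>{d r}. Q (x(r := y)) (X(r := s)))"
    using xr by (intro sum.mono_neutral_right ballI zero) auto
  finally show ?thesis
    using pos by simp
qed

theorem theorem5:
  fixes N j :: nat
    and d :: "nat \<Rightarrow> nat"
    and \<rho> :: "complex mat"
    and u v :: "nat \<Rightarrow> nat \<Rightarrow> complex mat"
    and P :: correlation
    and q :: real
  assumes "2 \<le> N"
    and "\<forall>i\<in>{1..N}. 2 \<le> d i"
    and "density_operator (\<Prod>i\<in>{1..N}. d i) \<rho>"
    and "\<forall>i\<in>{1..N}. observable (d i) (u i)"
    and "\<forall>i\<in>{1..N}. observable (d i) (v i)"
    and "P = quantum_correlation N \<rho> u v"
    and "j \<in> {1..N}"
    and "P (\<lambda>k\<in>{1..N}. 1) (\<lambda>k\<in>{1..N}. U) = q" and "q > 0"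
    and "\<forall>r\<in>{1..N}. \<forall>x\<in>{1..d r - 1}.
           P ((\<lambda>k\<in>{1..N}. 1)(r := x)) ((\<lambda>k\<in>{1..N}. U)(r := V)) = 0"
    and "\<forall>i\<in>{1..N}. i \<noteq> j \<longrightarrow>
           P ((\<lambda>k\<in>{1..N}. 1)(i := d i, j := d j)) ((\<lambda>k\<in>{1..N}. U)(i := V, j := V)) = 0"
  shows "genuinely_NS_nonlocal N d P"
  unfolding genuinely_NS_nonlocal_def
proof
  define one :: "nat \<Rightarrow> nat" where "one = (\<lambda>k\<in>{1..N}. 1)"
  define us :: "nat \<Rightarrow> setting" where "us = (\<lambda>k\<in>{1..N}. U)"
  \<comment> \<open>This makes both 1 and \<open>d i\<close> legitimate outcomes of party
    \<open>i\<close>.\<close>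
  have d1: "1 \<le> d i" if "i \<in> {1..N}" for i
    using assms(2) that by fastforce
  have one: "one \<in> outcomes d {1..N}"
    using d1 by (auto simp: one_def outcomes_def)
  have us: "us \<in> settings {1..N}"
    by (simp add: us_def settings_def)
  assume "NS2_local N d P"
  then obtain L :: "nat set" and w Q R where local: "(\<forall>\<alpha>\<in>proper_parts N. \<forall>l\<in>L. 0 \<le> w \<alpha> l \<and>
        ns_correlation d \<alpha> (Q \<alpha> l) \<and> ns_correlation d ({1..N} - \<alpha>) (R \<alpha> l)) \<and>
      ((\<lambda>(\<alpha>, l). w \<alpha> l) has_sum 1) (proper_parts N \<times> L) \<and>
      (\<forall>x\<in>outcomes d {1..N}. \<forall>X\<in>settings {1..N}.
        ((\<lambda>(\<alpha>, l). w \<alpha> l * Q \<alpha> l (restrict x \<alpha>) (restrict X \<alpha>)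
             * R \<alpha> l (restrict x ({1..N} - \<alpha>)) (restrict X ({1..N} - \<alpha>)))
          has_sum P x X) (proper_parts N \<times> L))"
    unfolding NS2_local_def by (elim exE) (rule that)
  have decomp: "0 \<le> w \<alpha> l \<and> ns_correlation d \<alpha> (Q \<alpha> l) \<and> ns_correlation d ({1..N} - \<alpha>) (R \<alpha> l)"
    if "\<alpha> \<in> proper_parts N" "l \<in> L" for \<alpha> l
    using local that by blast
  define t where "t = (\<lambda>x X (\<alpha>, l). w \<alpha> l * Q \<alpha> l (restrict x \<alpha>) (restrict X \<alpha>)
    * R \<alpha> l (restrict x ({1..N} - \<alpha>)) (restrict X ({1..N} - \<alpha>)))"
  have t_sum: "(t x X has_sum P x X) (proper_parts N \<times> L)"
    if "x \<in> outcomes d {1..N}" "X \<in> settings {1..N}" for x X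
    using conjunct2[OF conjunct2[OF local]] that by (simp add: t_def)
  have Q_nonneg: "0 \<le> Q \<alpha> l (restrict x \<alpha>) (restrict X \<alpha>)"
    if "\<alpha> \<in> proper_parts N" "l \<in> L" "x \<in> outcomes d {1..N}" for \<alpha> l x X
    using decomp[OF that(1,2)] that(1)
    by (intro ns_correlation_nonneg[of d \<alpha> "Q \<alpha> l"] outcomes_restrict[OF that(3)] settings_restrict)
      (simp_all add: proper_parts_def)
  have R_nonneg: "0 \<le> R \<alpha> l (restrict x ({1..N} - \<alpha>)) (restrict X ({1..N} - \<alpha>))"
    if "\<alpha> \<in> proper_parts N" "l \<in> L" "x \<in> outcomes d {1..N}" for \<alpha> l x X
    using decomp[OF that(1,2)]
    by (intro ns_correlation_nonneg[of d "{1..N} - \<alpha>" "R \<alpha> l"] outcomes_restrict[OF that(3)]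
        settings_restrict) simp_all
  have t_zero: "t x X (\<alpha>, l) = 0"
    if "P x X = 0" "\<alpha> \<in> proper_parts N" "l \<in> L" "x \<in> outcomes d {1..N}" "X \<in> settings {1..N}"
    for x X \<alpha> l
    using t_sum[OF that(4,5)] that decomp Q_nonneg R_nonneg
    by (intro nonneg_has_sum_le_0D[where A = "proper_parts N \<times> L" and f = "t x X"])
      (auto simp: t_def)
  \<comment> \<open>If all terms vanished, uniqueness of the sum would give
    \<open>q = 0\<close>.\<close>
  have "\<exists>p\<in>proper_parts N \<times> L. t one us p \<noteq> 0"
  proof (rule ccontr)
    assume "\<not> ?thesis"
    then have "(t one us has_sum 0) (proper_parts N \<times> L)"
      by (intro has_sum_0) auto
    from has_sum_unique[OF this t_sum[OF one us]] show False
      using assms(8,9) by (simp add: one_def us_def)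
  qed
  then obtain \<alpha> l where \<alpha>: "\<alpha> \<in> proper_parts N" and l: "l \<in> L" and "t one us (\<alpha>, l) \<noteq> 0"
    by auto
  define \<beta> where "\<beta> = {1..N} - \<alpha>"
  let ?oneA = "restrict one \<alpha>" and ?oneB = "restrict one \<beta>"
    and ?usA = "restrict us \<alpha>" and ?usB = "restrict us \<beta>"
  have parts: "\<alpha> \<union> \<beta> = {1..N}" "\<alpha> \<inter> \<beta> = {}" "\<alpha> \<subseteq> {1..N}" "\<beta> \<subseteq> {1..N}"
    using \<alpha> by (auto simp: \<beta>_def proper_parts_def)
  have t_eq: "t x X (\<alpha>, l) = w \<alpha> l * Q \<alpha> l (restrict x \<alpha>) (restrict X \<alpha>)
      * R \<alpha> l (restrict x \<beta>) (restrict X \<beta>)" for x X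
    by (simp add: t_def \<beta>_def)
  \<comment> \<open>A nonzero product of nonnegative factors has only positive factors.\<close>
  have pos: "0 < w \<alpha> l" "0 < Q \<alpha> l ?oneA ?usA" "0 < R \<alpha> l ?oneB ?usB"
    using \<open>t one us (\<alpha>, l) \<noteq> 0\<close> decomp[OF \<alpha> l] Q_nonneg[OF \<alpha> l one, of us]
      R_nonneg[OF \<alpha> l one, of us]
    unfolding t_eq \<beta>_def by (auto simp: less_le)
  have switch_zero: "t (one(r := x)) (us(r := V)) (\<alpha>, l) = 0"
    if "r \<in> {1..N}" "x \<in> {1..d r - 1}" for r x
    using assms(10) that \<alpha> l one us
    by (intro t_zero outcomes_fun_upd settings_fun_upd) (auto simp: one_def us_def)
  have not_B: "r \<notin> \<beta>" if "r \<in> \<alpha>" for r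
    using that by (simp add: \<beta>_def)
  have not_A: "r \<notin> \<alpha>" if "r \<in> \<beta>" for r
    using that by (simp add: \<beta>_def)
  \<comment> \<open>Switching a party of \<alpha> leaves the arguments of \<open>R\<close>
    unchanged, so the positive \<open>w\<close> and \<open>R\<close> cancel from
    \<open>switch_zero\<close> and the zero falls on \<open>Q\<close>.\<close>
  have Q_pos: "0 < Q \<alpha> l (?oneA(r := d r)) (?usA(r := V))" if r: "r \<in> \<alpha>" for r
  proof (rule ns_correlation_pos_switch[where Q = "Q \<alpha> l", OF _
      outcomes_restrict[OF one parts(3)] settings_restrict r pos(2)])
    show "Q \<alpha> l (?oneA(r := x)) (?usA(r := V)) = 0" if "x \<in> {1..d r - 1}" for x
      using switch_zero[OF subsetD[OF parts(3) r] that] pos(1,3)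
      unfolding t_eq restrict_fupd_in[OF r] restrict_fupd[OF not_B[OF r]] by simp
  qed (use decomp[OF \<alpha> l] in blast)
  have R_pos: "0 < R \<alpha> l (?oneB(r := d r)) (?usB(r := V))" if r: "r \<in> \<beta>" for r
  proof (rule ns_correlation_pos_switch[where Q = "R \<alpha> l", OF _
      outcomes_restrict[OF one parts(4)] settings_restrict r pos(3)])
    show "R \<alpha> l (?oneB(r := x)) (?usB(r := V)) = 0" if "x \<in> {1..d r - 1}" for x
      using switch_zero[OF subsetD[OF parts(4) r] that] pos(1,2)
      unfolding t_eq restrict_fupd_in[OF r] restrict_fupd[OF not_A[OF r]] by simp
  qed (use decomp[OF \<alpha> l] in \<open>simp add: \<beta>_def\<close>)
  \<comment> \<open>Each factor sees exactly one of the two updates, so this value is the product of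
    \<open>w\<close>, \<open>Q_pos\<close> and \<open>R_pos\<close>.\<close>
  have t_pos: "0 < t (one(a := d a, b := d b)) (us(a := V, b := V)) (\<alpha>, l)"
    if "a \<in> \<alpha>" "b \<in> \<beta>" for a b
    using Q_pos[OF that(1)] R_pos[OF that(2)] pos(1)
    unfolding t_eq restrict_fupd_in[OF that(1)] restrict_fupd[OF not_B[OF that(1)]]
      restrict_fupd_in[OF that(2)] restrict_fupd[OF not_A[OF that(2)]]
    by (intro mult_pos_pos)
  have t_cond3: "t (one(i := d i, j := d j)) (us(i := V, j := V)) (\<alpha>, l) = 0"
    if "i \<in> {1..N}" "i \<noteq> j" for i
  proof (rule t_zero[OF _ \<alpha> l])
    show "P (one(i := d i, j := d j)) (us(i := V, j := V)) = 0"
      using assms(11) that unfolding one_def us_def by blast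
    show "one(i := d i, j := d j) \<in> outcomes d {1..N}"
      using d1 that(1) assms(7) by (intro outcomes_fun_upd one) auto
    show "us(i := V, j := V) \<in> settings {1..N}"
      using that(1) assms(7) by (intro settings_fun_upd us)
  qed
  obtain a where a: "a \<in> \<alpha>"
    using \<alpha> by (fastforce simp: proper_parts_def)
  \<comment> \<open>Otherwise \<alpha> would have \<open>N\<close> elements, more than the
    \<open>N - 1\<close> allowed for a proper part.\<close>
  have "\<beta> \<noteq> {}"
  proof
    assume "\<beta> = {}"
    then have "\<alpha> = {1..N}" using parts by auto
    then show False using \<alpha> assms(1) by (simp add: proper_parts_def)
  qed
  then obtain b where b: "b \<in> \<beta>"
    by auto
  show False
  proof (cases "j \<in> \<alpha>")
    case True
    then have "b \<noteq> j" "b \<in> {1..N}" using b parts by auto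
    then show False
      \<comment> \<open>\<open>t_pos\<close> updates the party of \<alpha> first, whereas condition
        3 updates \<open>j\<close> last; with \<open>j\<close> in \<alpha> the two updates must be
        swapped, which \<open>b \<noteq> j\<close> permits.\<close>
      using t_pos[OF True b] t_cond3[of b] by (simp add: fun_upd_twist)
  next
    case False
    then have "j \<in> \<beta>" "a \<noteq> j" "a \<in> {1..N}" using a assms(7) parts by auto
    then show False
      using t_pos[OF a, of j] t_cond3[of a] by simp
  qed
qed

end
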